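(* Let $\langle S,A,T,R,\kappa\rangle$ be a PSO-MDP with discount factor $\gamma\in[0,1)$ and optimal Q-values $Q^*(s,a)$. Let $\tau$ be an integer with $1\le\tau<\kappa$, let $u\in A^{\kappa-\tau}$ be an arbitrary fixed action suffix, and consider the restriction of the PSO-MDP to the action sequences $\underline{A}_\tau^u=\{a\in A^\kappa: a_{\tau:\kappa}=u\}$ with suffix $u$, with Q-values $\underline{Q}^*(s,a)$. For $s\in S$ and a prefix $a_{0:\tau}\in A^\tau$ define $$Q^*(s,a_{0:\tau})=\max_{\hat a\in A^\kappa,\ \hat a_{0:\tau}=a_{0:\tau}}Q^*(s,\hat a).$$ Then for all $s\in S$ and all $a_{0:\tau}\in A^\tau$, $$Q^*(s,a_{0:\tau})\ \ge\ \underline{Q}^*(s,(a_{0:\tau}u)),$$ where $(a_{0:\tau}u)\in A^\kappa$ denotes the concatenation of $a_{0:\tau}$ and $u$.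
   Context: A periodically state-observed Markov Decision Process (PSO-MDP) is a tuple $\langle S,A,T,R,\kappa\rangle$ with $S$ a finite nonempty set of states, $A$ a finite nonempty set of actions, $T:S\times A\times S\to[0,1]$ the Markovian transition model, where $T(s',a,s)=P(s^{t+1}=s'\mid s^t=s,a^t=a)$ (so $\sum_{s'}T(s',a,s)=1$), $R:S\times A\to\mathbb{R}$ the reward function, and $\kappa\in\mathbb{N}_{>0}$ the check-in period. The agent acts at every time step, but the state is revealed to it only at times $0,\kappa,2\kappa,\dots$; it maximizes the expected discounted reward $\mathbb{E}\left(\sum_{t\ge0}\gamma^tR(s^t,a^t)\right)$. For $a=(a_0,\dots,a_{\kappa-1})\in A^\kappa$: $$T^{\kappa}(s',a,s)=\sum_{(s_0,\dots,s_\kappa)\in S^{\kappa+1},\ s_0=s,\ s_\kappa=s'}\ \prod_{i=0}^{\kappa-1}T(s_{i+1},a_i,s_i),$$ $$R^{\kappa,\gamma}(s,a)=\sum_{d=0}^{\kappa-1}\gamma^d\sum_{(s_0,\dots,s_d)\in S^{d+1},\ s_0=s}R(s_d,a_d)\prod_{i=0}^{d-1}T(s_{i+1},a_i,s_i).$$ For $a\in A^\kappa$, $a_{\ell:m}=(a_\ell,\dots,a_{m-1})$. The optimal Q-values $Q^*:S\times A^\kappa\to\mathbb{R}$ are the unique solution of $$Q^*(s,a)=R^{\kappa,\gamma}(s,a)+\gamma^\kappa\sum_{s'\in S}T^\kappa(s',a,s)\max_{a'\in A^\kappa}Q^*(s',a').$$ The Q-values of the restricted PSO-MDP, $\underline{Q}^*:S\times\underline{A}_\tau^u\to\mathbb{R}$,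 are the unique solution of $$\underline{Q}^*(s,a)=R^{\kappa,\gamma}(s,a)+\gamma^\kappa\sum_{s'\in S}T^\kappa(s',a,s)\max_{a'\in\underline{A}_\tau^u}\underline{Q}^*(s',a'),\qquad a\in\underline{A}_\tau^u.$$ *)

theory Defs
  imports Complex_Main "HOL-Library.FuncSet"
begin

text \<open>
  The finite nonempty sets of states and actions are the types \<open>'s\<close> and \<open>'a\<close> of class
  \<open>finite\<close>. As in \<open>T(s', a, s)\<close>, the successor state is the first argument of a transition
  model. An element of \<open>A\<^sup>n\<close> is a list of length \<open>n\<close>, indexed from 0, so that for
  \<open>length a = \<kappa>\<close> the prefix \<open>a\<^sub>0, \<dots>, a\<^bsub>\<tau>-1\<^esub>\<close> is \<open>take \<tau> a\<close> and the suffix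
  \<open>a\<^sub>\<tau>, \<dots>, a\<^bsub>\<kappa>-1\<^esub>\<close> is \<open>drop \<tau> a\<close>.
\<close>

definition pso_mdp ::
  "('s::finite \<Rightarrow> 'a::finite \<Rightarrow> 's \<Rightarrow> real) \<Rightarrow> ('s \<Rightarrow> 'a \<Rightarrow> real) \<Rightarrow> nat \<Rightarrow> bool" where
  "pso_mdp T R \<kappa> \<longleftrightarrow>
     (\<forall>s' a s. 0 \<le> T s' a s \<and> T s' a s \<le> 1) \<and>
     (\<forall>a s. (\<Sum>s'\<in>UNIV. T s' a s) = 1) \<and>
     0 < \<kappa>"

definition action_seqs :: "nat \<Rightarrow> 'a::finite list set" where
  "action_seqs n = {a. length a = n}"

definition trans_seq ::
  "('s::finite \<Rightarrow> 'a::finite \<Rightarrow> 's \<Rightarrow> real) \<Rightarrow> nat \<Rightarrow> 's \<Rightarrow> 'a list \<Rightarrow> 's \<Rightarrow> real" where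
  "trans_seq T \<kappa> s' a s =
     (\<Sum>p\<in>{p. length p = \<kappa> + 1 \<and> p ! 0 = s \<and> p ! \<kappa> = s'}.
        \<Prod>i<\<kappa>. T (p ! (i + 1)) (a ! i) (p ! i))"

definition reward_seq ::
  "('s::finite \<Rightarrow> 'a::finite \<Rightarrow> 's \<Rightarrow> real) \<Rightarrow> ('s \<Rightarrow> 'a \<Rightarrow> real) \<Rightarrow> nat \<Rightarrow> real \<Rightarrow>
     's \<Rightarrow> 'a list \<Rightarrow> real" where
  "reward_seq T R \<kappa> \<gamma> s a =
     (\<Sum>d<\<kappa>. \<gamma> ^ d *
        (\<Sum>p\<in>{p. length p = d + 1 \<and> p ! 0 = s}.
           R (p ! d) (a ! d) * (\<Prod>i<d. T (p ! (i + 1)) (a ! i) (p ! i))))"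

definition bellman ::
  "('s::finite \<Rightarrow> 'a::finite \<Rightarrow> 's \<Rightarrow> real) \<Rightarrow> ('s \<Rightarrow> 'a \<Rightarrow> real) \<Rightarrow> nat \<Rightarrow> real \<Rightarrow>
     'a list set \<Rightarrow> ('s \<times> 'a list \<Rightarrow> real) \<Rightarrow> bool" where
  "bellman T R \<kappa> \<gamma> B Q \<longleftrightarrow>
     (\<forall>s. \<forall>a\<in>B. Q (s, a) =
        reward_seq T R \<kappa> \<gamma> s a +
        \<gamma> ^ \<kappa> * (\<Sum>s'\<in>UNIV. trans_seq T \<kappa> s' a s * Max ((\<lambda>a'. Q (s', a')) ` B)))"

text \<open>
  The Q-values for the set \<open>B\<close> of admissible action sequences are a function on \<open>S \<times> B\<close>.
  Restricting to extensional functions (\<open>undefined\<close> outside this domain) is what makes the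
  solution of the Bellman equation unique as a HOL function.
\<close>

definition q_values ::
  "('s::finite \<Rightarrow> 'a::finite \<Rightarrow> 's \<Rightarrow> real) \<Rightarrow> ('s \<Rightarrow> 'a \<Rightarrow> real) \<Rightarrow> nat \<Rightarrow> real \<Rightarrow>
     'a list set \<Rightarrow> 's \<times> 'a list \<Rightarrow> real" where
  "q_values T R \<kappa> \<gamma> B =
     (THE Q. Q \<in> extensional (UNIV \<times> B) \<and> bellman T R \<kappa> \<gamma> B Q)"

definition q_opt ::
  "('s::finite \<Rightarrow> 'a::finite \<Rightarrow> 's \<Rightarrow> real) \<Rightarrow> ('s \<Rightarrow> 'a \<Rightarrow> real) \<Rightarrow> nat \<Rightarrow> real \<Rightarrow>
     's \<Rightarrow> 'a list \<Rightarrow> real" where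
  "q_opt T R \<kappa> \<gamma> s a = q_values T R \<kappa> \<gamma> (action_seqs \<kappa>) (s, a)"

definition q_opt_prefix ::
  "('s::finite \<Rightarrow> 'a::finite \<Rightarrow> 's \<Rightarrow> real) \<Rightarrow> ('s \<Rightarrow> 'a \<Rightarrow> real) \<Rightarrow> nat \<Rightarrow> real \<Rightarrow>
     nat \<Rightarrow> 's \<Rightarrow> 'a list \<Rightarrow> real" where
  "q_opt_prefix T R \<kappa> \<gamma> \<tau> s p =
     Max {q_opt T R \<kappa> \<gamma> s a |a. a \<in> action_seqs \<kappa> \<and> take \<tau> a = p}"

definition suffix_seqs :: "nat \<Rightarrow> nat \<Rightarrow> 'a::finite list \<Rightarrow> 'a list set" where
  "suffix_seqs \<kappa> \<tau> u = {a \<in> action_seqs \<kappa>. drop \<tau> a = u}"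

definition q_restricted ::
  "('s::finite \<Rightarrow> 'a::finite \<Rightarrow> 's \<Rightarrow> real) \<Rightarrow> ('s \<Rightarrow> 'a \<Rightarrow> real) \<Rightarrow> nat \<Rightarrow> real \<Rightarrow>
     nat \<Rightarrow> 'a list \<Rightarrow> 's \<Rightarrow> 'a list \<Rightarrow> real" where
  "q_restricted T R \<kappa> \<gamma> \<tau> u s a = q_values T R \<kappa> \<gamma> (suffix_seqs \<kappa> \<tau> u) (s, a)"

end

(*
  Both Q-functions solve a Bellman equation for the same rewards and the same stochastic kernel.
  If Q1 and Q2 solve it for B1 \<subseteq> B2 and m is the maximum of Q1 - Q2 on B1, then subtracting the
  two equations gives m \<le> q m for the discount q < 1, so m \<le> 0. This comparison yields both the
  theorem and (for B1 = B2) uniqueness of solutions. A solution exists because the supremum of all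
  V with V \<le> L V, for the monotone Bellman operator L on state values, is a fixed point of L.
*)
theory Submission
  imports Defs
begin

section \<open>Path weights and the multi-step transition kernel\<close>

lemma finite_paths: "finite {p :: 's::finite list. length p = n \<and> P p}"
  by (rule finite_subset[OF _ finite_lists_length_eq[of UNIV n]]) auto

lemma finite_action_seqs: "finite (action_seqs n)"
  using finite_paths[of n "\<lambda>_. True"] by (simp add: action_seqs_def)

lemma trans_seq_nonneg:
  assumes "\<And>s' a s. 0 \<le> T s' a s"
  shows "0 \<le> trans_seq T \<kappa> s' a s"
  unfolding trans_seq_def by (intro sum_nonneg prod_nonneg assms)

text \<open>Induction on the number of steps: a path with one more step is a shorter path plus a
  final state, and summing over that state contributes the factor 1. Positions past the end of
  \<open>a\<close> denote some unspecified action, to which \<open>T1\<close> applies as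
  well.\<close>

lemma sum_path_weights:
  fixes T :: "'s::finite \<Rightarrow> 'a::finite \<Rightarrow> 's \<Rightarrow> real"
  assumes T1: "\<And>a s. (\<Sum>s'\<in>UNIV. T s' a s) = 1"
  shows "(\<Sum>p\<in>{p. length p = n + 1 \<and> p ! 0 = s}. \<Prod>i<n. T (p ! (i + 1)) (a ! i) (p ! i)) = 1"
proof (induction n)
  case 0
  have "{p. length p = 0 + 1 \<and> p ! 0 = s} = {[s]}"
    by (auto simp: length_Suc_conv)
  then show ?case by simp
next
  case (Suc n)
  let ?X = "\<lambda>n. {p. length p = n + 1 \<and> p ! 0 = s}"
  let ?w = "\<lambda>n p. \<Prod>i<n. T (p ! (i + 1)) (a ! i) (p ! i)"
  have bij: "bij_betw (\<lambda>(p, t). p @ [t]) (?X n \<times> UNIV) (?X (Suc n))"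
  proof (rule bij_betw_byWitness[where f' = "\<lambda>p. (butlast p, last p)"])
    show "(\<lambda>p. (butlast p, last p)) ` ?X (Suc n) \<subseteq> ?X n \<times> UNIV"
      by (auto simp: nth_butlast)
    show "\<forall>p\<in>?X (Suc n). (case (butlast p, last p) of (p, t) \<Rightarrow> p @ [t]) = p"
      by (auto intro!: append_butlast_last_id)
  qed (auto simp: nth_append)
  have step: "?w (Suc n) (p @ [t]) = ?w n p * T t (a ! n) (p ! n)" if "p \<in> ?X n" for p t
  proof -
    \<comment> \<open>The first \<open>n\<close> factors read only positions up to \<open>n\<close>,
      all of which lie inside \<open>p\<close>.\<close>
    have "?w n (p @ [t]) = ?w n p"
      using that by (intro prod.cong) (auto simp: nth_append)
    then show ?thesis
      using that by (simp add: nth_append)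
  qed
  have "(\<Sum>p\<in>?X (Suc n). ?w (Suc n) p) = (\<Sum>(p, t)\<in>?X n \<times> UNIV. ?w (Suc n) (p @ [t]))"
    by (subst sum.reindex_bij_betw[OF bij, symmetric]) (simp add: case_prod_unfold)
  also have "\<dots> = (\<Sum>p\<in>?X n. \<Sum>t\<in>UNIV. ?w (Suc n) (p @ [t]))"
    by (rule sum.cartesian_product[symmetric])
  also have "\<dots> = (\<Sum>p\<in>?X n. ?w n p)"
    by (intro sum.cong refl) (simp only: step sum_distrib_left[symmetric] T1 mult_1_right)
  finally show ?case
    using Suc.IH by simp
qed

text \<open>Grouping the paths from \<open>s\<close> by their end state turns the double sum into
  the total path weight.\<close>

lemma sum_trans_seq:
  fixes T :: "'s::finite \<Rightarrow> 'a::finite \<Rightarrow> 's \<Rightarrow> real"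
  assumes "\<And>a s. (\<Sum>s'\<in>UNIV. T s' a s) = 1"
  shows "(\<Sum>s'\<in>UNIV. trans_seq T \<kappa> s' a s) = 1"
proof -
  let ?X = "{p. length p = \<kappa> + 1 \<and> p ! 0 = s}"
  have "(\<Sum>s'\<in>UNIV. trans_seq T \<kappa> s' a s) =
      (\<Sum>s'\<in>UNIV. \<Sum>p\<in>{p\<in>?X. p ! \<kappa> = s'}. \<Prod>i<\<kappa>. T (p ! (i + 1)) (a ! i) (p ! i))"
    unfolding trans_seq_def by (intro sum.cong refl) auto
  also have "\<dots> = (\<Sum>p\<in>?X. \<Prod>i<\<kappa>. T (p ! (i + 1)) (a ! i) (p ! i))"
    by (rule sum.group) (auto simp: finite_paths)
  also have "\<dots> = 1"
    by (rule sum_path_weights) (rule assms)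
  finally show ?thesis .
qed

section \<open>Bellman equations: comparison, existence and uniqueness\<close>

lemma average_le:
  fixes w f :: "'s::finite \<Rightarrow> real"
  assumes "\<And>s. 0 \<le> w s" and "(\<Sum>s\<in>UNIV. w s) = 1" and "\<And>s. f s \<le> c"
  shows "(\<Sum>s\<in>UNIV. w s * f s) \<le> c"
proof -
  have "(\<Sum>s\<in>UNIV. w s * f s) \<le> (\<Sum>s\<in>UNIV. w s * c)"
    by (intro sum_mono mult_left_mono assms)
  then show ?thesis
    by (simp add: sum_distrib_right[symmetric] assms(2))
qed

lemma bellman_mono:
  fixes Q1 Q2 :: "'s::finite \<times> 'a::finite list \<Rightarrow> real"
  assumes P0: "\<And>s' a s. 0 \<le> trans_seq T \<kappa> s' a s"
    and P1: "\<And>a s. (\<Sum>s'\<in>UNIV. trans_seq T \<kappa> s' a s) = 1"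
    and q: "0 \<le> \<gamma> ^ \<kappa>" "\<gamma> ^ \<kappa> < 1"
    and fin: "finite B2" and sub: "B1 \<subseteq> B2"
    and Q1: "bellman T R \<kappa> \<gamma> B1 Q1" and Q2: "bellman T R \<kappa> \<gamma> B2 Q2"
    and a: "a \<in> B1"
  shows "Q1 (s, a) \<le> Q2 (s, a)"
proof -
  let ?D = "(\<lambda>x. Q1 x - Q2 x) ` (UNIV \<times> B1)"
  define m where "m = Max ?D"
  have fin1: "finite B1"
    using fin sub by (rule finite_subset[rotated])
  then have finD: "finite ?D" by simp
  have m_ge: "Q1 (t, b) - Q2 (t, b) \<le> m" if "b \<in> B1" for t b
    unfolding m_def using finD that by (intro Max_ge) auto
  \<comment> \<open>The action maximising \<open>Q1\<close> at \<open>t\<close> also competes in the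
    maximum over \<open>B2\<close>, so both values are compared at this one action.\<close>
  have max_diff: "Max ((\<lambda>b. Q1 (t, b)) ` B1) - Max ((\<lambda>b. Q2 (t, b)) ` B2) \<le> m" for t
  proof -
    have "Max ((\<lambda>b. Q1 (t, b)) ` B1) \<in> (\<lambda>b. Q1 (t, b)) ` B1"
      using fin1 a by (intro Max_in) auto
    then obtain b where b: "b \<in> B1" "Max ((\<lambda>b. Q1 (t, b)) ` B1) = Q1 (t, b)"
      by auto
    have "Q2 (t, b) \<le> Max ((\<lambda>b. Q2 (t, b)) ` B2)"
      using fin b sub by (intro Max_ge) auto
    with m_ge[OF b(1), of t] b(2) show ?thesis by linarith
  qed
  have le_qm: "Q1 (t, b) - Q2 (t, b) \<le> \<gamma> ^ \<kappa> * m" if b: "b \<in> B1" for t b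
  proof -
    \<comment> \<open>Both equations hold at \<open>b\<close> because \<open>B1\<close> is contained
      in \<open>B2\<close>; the reward terms cancel.\<close>
    have "Q1 (t, b) - Q2 (t, b) = \<gamma> ^ \<kappa> * (\<Sum>s'\<in>UNIV. trans_seq T \<kappa> s' b t *
        (Max ((\<lambda>b. Q1 (s', b)) ` B1) - Max ((\<lambda>b. Q2 (s', b)) ` B2)))"
      using Q1 Q2 b sub unfolding bellman_def
      by (force simp: right_diff_distrib sum_subtractf)
    also have "\<dots> \<le> \<gamma> ^ \<kappa> * m"
      by (intro mult_left_mono average_le P0 P1 max_diff q)
    finally show ?thesis .
  qed
  \<comment> \<open>The maximum is attained, so \<open>le_qm\<close> may be applied at a
    maximiser.\<close>
  have "m \<in> ?D"
    unfolding m_def using finD a by (intro Max_in) auto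
  then have "m \<le> \<gamma> ^ \<kappa> * m"
    using le_qm by auto
  then have "(1 - \<gamma> ^ \<kappa>) * m \<le> 0"
    by (simp add: left_diff_distrib)
  then have "m \<le> 0"
    using q by (simp add: mult_le_0_iff)
  with m_ge[OF a, of s] show ?thesis by linarith
qed

text \<open>A Knaster-Tarski argument. The reals are only conditionally complete, so the set
  \<open>X\<close> of all \<open>V\<close> below \<open>L V\<close> must first be shown nonempty and
  pointwise bounded above. The Q-function is then the one-step lookahead \<open>f U\<close> from the
  fixed point \<open>U\<close>.\<close>

lemma bellman_exists:
  fixes T :: "'s::finite \<Rightarrow> 'a::finite \<Rightarrow> 's \<Rightarrow> real"
  assumes P0: "\<And>s' a s. 0 \<le> trans_seq T \<kappa> s' a s"
    and P1: "\<And>a s. (\<Sum>s'\<in>UNIV. trans_seq T \<kappa> s' a s) = 1"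
    and q: "0 \<le> \<gamma> ^ \<kappa>" "\<gamma> ^ \<kappa> < 1"
    and fin: "finite B" and ne: "B \<noteq> {}"
  obtains Q where "Q \<in> extensional (UNIV \<times> B)" "bellman T R \<kappa> \<gamma> B Q"
proof -
  define r where "r = reward_seq T R \<kappa> \<gamma>"
  define f where "f V s a = r s a + \<gamma> ^ \<kappa> * (\<Sum>s'\<in>UNIV. trans_seq T \<kappa> s' a s * V s')" for V s a
  define L where "L V s = Max (f V s ` B)" for V s
  define X where "X = {V. \<forall>s. V s \<le> L V s}"
  define C where "C = Max ((\<lambda>(s, a). \<bar>r s a\<bar>) ` (UNIV \<times> B))"
  define U where "U s = (SUP V\<in>X. V s)" for s
  have C: "\<bar>r s a\<bar> \<le> C" if "a \<in> B" for s a
    unfolding C_def using fin that by (intro Max_ge) auto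
  have f_mono: "f V s a \<le> f W s a" if "\<And>s. V s \<le> W s" for V W s a
    unfolding f_def by (intro add_left_mono mult_left_mono sum_mono that P0 q)
  have f_le_L: "f V s a \<le> L V s" if "a \<in> B" for V s a
    unfolding L_def using fin that by (intro Max_ge) auto
  have L_le: "L V s \<le> c" if "\<And>a. a \<in> B \<Longrightarrow> f V s a \<le> c" for V s c
    unfolding L_def using fin ne that by (subst Max_le_iff) auto
  have L_mono: "L V s \<le> L W s" if "\<And>s. V s \<le> W s" for V W s
    by (rule L_le, rule order_trans[OF f_mono f_le_L]) (use that in auto)
  have bound: "V s \<le> C / (1 - \<gamma> ^ \<kappa>)" if V: "V \<in> X" for V s
  proof -
    \<comment> \<open>At a state where \<open>V\<close> attains its maximum \<open>m\<close>,
      membership in \<open>X\<close> gives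
      \<open>m \<le> C + \<gamma> ^ \<kappa> * m\<close>.\<close>
    define m where "m = Max (range V)"
    have Vm: "V t \<le> m" for t
      unfolding m_def by (intro Max_ge) auto
    have "m \<in> range V"
      unfolding m_def by (intro Max_in) auto
    then obtain t where t: "m = V t" by auto
    have "L V t \<le> C + \<gamma> ^ \<kappa> * m"
    proof (rule L_le)
      fix a assume "a \<in> B"
      then have "r t a \<le> C" using C[of a t] by linarith
      then show "f V t a \<le> C + \<gamma> ^ \<kappa> * m"
        unfolding f_def by (intro add_mono mult_left_mono average_le P0 P1 Vm q)
    qed
    moreover have "m \<le> L V t"
      using V t by (simp add: X_def)
    ultimately have "m * (1 - \<gamma> ^ \<kappa>) \<le> C"
      by (simp add: algebra_simps)
    then have "m \<le> C / (1 - \<gamma> ^ \<kappa>)"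
      using q by (simp add: pos_le_divide_eq)
    with Vm[of s] show ?thesis by linarith
  qed
  have X_ne: "X \<noteq> {}"
  proof -
    \<comment> \<open>The value of receiving the worst-case reward \<open>- C\<close> in every
      period, i.e. the solution of \<open>c = - C + \<gamma> ^ \<kappa> * c\<close>.\<close>
    let ?c = "- (C / (1 - \<gamma> ^ \<kappa>))"
    obtain a where a: "a \<in> B" using ne by auto
    have c: "?c = - C + \<gamma> ^ \<kappa> * ?c"
      using q by (simp add: field_simps)
    have "?c \<le> L (\<lambda>_. ?c) s" for s
    proof -
      have "f (\<lambda>_. ?c) s a = r s a + \<gamma> ^ \<kappa> * ?c"
        unfolding f_def by (simp only: sum_distrib_right[symmetric] P1 mult_1_left)
      then show ?thesis
        using C[OF a, of s] c f_le_L[OF a, of "\<lambda>_. ?c" s] by linarith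
    qed
    then have "(\<lambda>_. ?c) \<in> X" by (simp add: X_def)
    then show ?thesis by blast
  qed
  have le_U: "V s \<le> U s" if "V \<in> X" for V s
    unfolding U_def using that bound by (intro cSUP_upper bdd_aboveI2) auto
  have U_le: "U s \<le> L U s" for s
    unfolding U_def[of s]
  proof (rule cSUP_least[OF X_ne])
    fix V assume V: "V \<in> X"
    then have "V s \<le> L V s" by (simp add: X_def)
    also have "\<dots> \<le> L U s" by (intro L_mono le_U V)
    finally show "V s \<le> L U s" .
  qed
  \<comment> \<open>Monotonicity carries \<open>U \<le> L U\<close> over to
    \<open>L U \<le> L (L U)\<close>; as a member of \<open>X\<close>, \<open>L U\<close> then lies
    below the supremum \<open>U\<close>.\<close>
  then have "L U \<in> X"
    by (auto simp: X_def intro: L_mono)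
  then have fixpoint: "L U s = U s" for s
    using U_le le_U by (intro antisym)
  define Q where "Q = (\<lambda>(s, a)\<in>UNIV \<times> B. f U s a)"
  \<comment> \<open>This identity turns the \<open>U\<close> inside \<open>f U\<close> into the
    maximum that the Bellman equation requires.\<close>
  have "Max ((\<lambda>a. Q (s, a)) ` B) = U s" for s
  proof -
    have "(\<lambda>a. Q (s, a)) ` B = f U s ` B"
      by (intro image_cong) (auto simp: Q_def)
    then show ?thesis using fixpoint[of s] by (simp add: L_def)
  qed
  then have "bellman T R \<kappa> \<gamma> B Q"
    by (simp add: bellman_def Q_def f_def r_def)
  moreover have "Q \<in> extensional (UNIV \<times> B)"
    by (simp add: Q_def)
  ultimately show ?thesis by (rule that[rotated])
qed

text \<open>Justifies the definite description: two solutions agree on the domain by comparison in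
  both directions, and off the domain by extensionality.\<close>

lemma bellman_q_values:
  fixes T :: "'s::finite \<Rightarrow> 'a::finite \<Rightarrow> 's \<Rightarrow> real"
  assumes "\<And>s' a s. 0 \<le> trans_seq T \<kappa> s' a s"
    and "\<And>a s. (\<Sum>s'\<in>UNIV. trans_seq T \<kappa> s' a s) = 1"
    and "0 \<le> \<gamma> ^ \<kappa>" "\<gamma> ^ \<kappa> < 1"
    and "finite B" and "B \<noteq> {}"
  shows "bellman T R \<kappa> \<gamma> B (q_values T R \<kappa> \<gamma> B)"
proof -
  obtain Q where Q: "Q \<in> extensional (UNIV \<times> B)" "bellman T R \<kappa> \<gamma> B Q"
    using assms by (rule bellman_exists)
  have "q_values T R \<kappa> \<gamma> B = Q"
    unfolding q_values_def
  proof (rule the_equality)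
    fix Q' assume Q': "Q' \<in> extensional (UNIV \<times> B) \<and> bellman T R \<kappa> \<gamma> B Q'"
    show "Q' = Q"
    proof (rule extensionalityI)
      fix x :: "'s \<times> 'a list" assume "x \<in> UNIV \<times> B"
      then obtain s a where x: "x = (s, a)" "a \<in> B" by auto
      have "Q' (s, a) \<le> Q (s, a)"
        by (rule bellman_mono[OF assms(1-5) subset_refl]) (use Q Q' x in auto)
      moreover have "Q (s, a) \<le> Q' (s, a)"
        by (rule bellman_mono[OF assms(1-5) subset_refl]) (use Q Q' x in auto)
      ultimately show "Q' x = Q x" using x by simp
    qed (use Q Q' in auto)
  qed (use Q in simp)
  with Q(2) show ?thesis by simp
qed

theorem theorem6:
  fixes T :: "'s::finite \<Rightarrow> 'a::finite \<Rightarrow> 's \<Rightarrow> real"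
    and R :: "'s \<Rightarrow> 'a \<Rightarrow> real"
    and \<kappa> \<tau> :: nat
    and \<gamma> :: real
    and u :: "'a list"
  assumes "pso_mdp T R \<kappa>"
    and "0 \<le> \<gamma>" and "\<gamma> < 1"
    and "1 \<le> \<tau>" and "\<tau> < \<kappa>"
    and "u \<in> action_seqs (\<kappa> - \<tau>)"
  shows "\<forall>s. \<forall>p\<in>action_seqs \<tau>.
           q_opt_prefix T R \<kappa> \<gamma> \<tau> s p \<ge> q_restricted T R \<kappa> \<gamma> \<tau> u s (p @ u)"
proof (intro allI ballI)
  fix s and p :: "'a list"
  assume p: "p \<in> action_seqs \<tau>"
  have P0: "0 \<le> trans_seq T \<kappa> s' a t" for s' a t
    using assms(1) by (intro trans_seq_nonneg) (simp add: pso_mdp_def)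
  have P1: "(\<Sum>s'\<in>UNIV. trans_seq T \<kappa> s' a t) = 1" for a t
    using assms(1) by (intro sum_trans_seq) (simp add: pso_mdp_def)
  \<comment> \<open>Strictness rests on \<open>\<kappa>\<close> being positive.\<close>
  have q: "0 \<le> \<gamma> ^ \<kappa>" "\<gamma> ^ \<kappa> < 1"
    using assms by (auto intro: power_less_one_iff[THEN iffD2])
  let ?A = "action_seqs \<kappa> :: 'a list set" and ?B = "suffix_seqs \<kappa> \<tau> u"
  have B: "?B \<subseteq> ?A" "p @ u \<in> ?B"
    using p assms by (auto simp: suffix_seqs_def action_seqs_def)
  have fin: "finite ?A" "finite ?B"
    using finite_action_seqs B(1) by (auto intro: finite_subset)
  have "bellman T R \<kappa> \<gamma> ?A (q_values T R \<kappa> \<gamma> ?A)" "bellman T R \<kappa> \<gamma> ?B (q_values T R \<kappa> \<gamma> ?B)"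
    using B by (auto intro!: bellman_q_values P0 P1 q fin)
  then have "q_restricted T R \<kappa> \<gamma> \<tau> u s (p @ u) \<le> q_opt T R \<kappa> \<gamma> s (p @ u)"
    unfolding q_restricted_def q_opt_def
    by (intro bellman_mono[OF P0 P1 q fin(1) B(1)] B(2))
  \<comment> \<open>The sequence \<open>p @ u\<close> is one of the completions of \<open>p\<close>
    over which the maximum is taken.\<close>
  also have "\<dots> \<le> q_opt_prefix T R \<kappa> \<gamma> \<tau> s p"
    unfolding q_opt_prefix_def
  proof (rule Max_ge)
    have "{q_opt T R \<kappa> \<gamma> s a |a. a \<in> ?A \<and> take \<tau> a = p} \<subseteq> q_opt T R \<kappa> \<gamma> s ` ?A"
      by auto
    then show "finite {q_opt T R \<kappa> \<gamma> s a |a. a \<in> ?A \<and> take \<tau> a = p}"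
      using fin(1) by (auto intro: finite_subset)
    have "p @ u \<in> ?A" "take \<tau> (p @ u) = p"
      using B p by (auto simp: action_seqs_def)
    then show "q_opt T R \<kappa> \<gamma> s (p @ u) \<in> {q_opt T R \<kappa> \<gamma> s a |a. a \<in> ?A \<and> take \<tau> a = p}"
      by blast
  qed
  finally show "q_opt_prefix T R \<kappa> \<gamma> \<tau> s p \<ge> q_restricted T R \<kappa> \<gamma> \<tau> u s (p @ u)" .
qed

end
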